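(* Let $(Y,X,V)$ be a random vector and $p(X)$ a known $J$-vector of functions of $X$. Suppose $E[p(X)p(X)'\mid V]$ is nonsingular with probability one and $E[Y^2]<\infty$. Define $q^*(V)\equiv E[p(X)p(X)'\mid V]^{-1}E[p(X)Y\mid V]$. Then $E[Y\mid X,V]=p(X)'q_0(V)$ for some $q_0(V)$ if, and only if, $E[\{Y-p(X)'q^*(V)\}a(X,V)]=0$ for all $a(X,V)$ with $E[a(X,V)^2]<\infty$.
   Context: $J$ is finite, $q_0$ is a measurable $J$-vector-valued function, $a$ is a measurable scalar function, and equalities between random variables hold almost surely. The conditional moments in the definition of $q^*$ are assumed to exist and be finite. *)

theory Defs
  imports "HOL-Probability.Probability"
begin

definition rv_algebra :: "'w measure \<Rightarrow> ('w \<Rightarrow> 'a::topological_space) \<Rightarrow> 'w measure" where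
  "rv_algebra M Z = vimage_algebra (space M) Z borel"

text \<open>
  The conditional expectation of \<open>f\<close> is not required to come from an integrable \<open>f\<close>:
  \<^const>\<open>real_cond_exp\<close> is the difference of the conditional expectations of the positive and
  negative parts, which is the usual generalised conditional expectation as soon as
  the conditional expectation of \<open>\<bar>f\<bar>\<close> is almost surely finite.
\<close>

definition finite_cond_moment :: "'w measure \<Rightarrow> 'w measure \<Rightarrow> ('w \<Rightarrow> real) \<Rightarrow> bool" where
  "finite_cond_moment M F f \<longleftrightarrow> (AE \<omega> in M. nn_cond_exp M F (\<lambda>\<omega>. ennreal \<bar>f \<omega>\<bar>) \<omega> < \<infinity>)"

definition cond_second_moment ::
  "'w measure \<Rightarrow> 'w measure \<Rightarrow> ('w \<Rightarrow> real ^ 'j) \<Rightarrow> 'w \<Rightarrow> real ^ 'j ^ 'j" where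
  "cond_second_moment M F P \<omega> = (\<chi> i j. real_cond_exp M F (\<lambda>\<omega>. P \<omega> $ i * P \<omega> $ j) \<omega>)"

definition cond_cross_moment ::
  "'w measure \<Rightarrow> 'w measure \<Rightarrow> ('w \<Rightarrow> real ^ 'j) \<Rightarrow> ('w \<Rightarrow> real) \<Rightarrow> 'w \<Rightarrow> real ^ 'j" where
  "cond_cross_moment M F P Y \<omega> = (\<chi> i. real_cond_exp M F (\<lambda>\<omega>. P \<omega> $ i * Y \<omega>) \<omega>)"

text \<open>
  The random vector \<open>q\<^sup>*(V)\<close>, as a function on the sample space; \<open>F\<close> is the
  sigma-algebra generated by \<open>V\<close> and \<open>P = p(X)\<close>.
\<close>

definition qstar ::
  "'w measure \<Rightarrow> 'w measure \<Rightarrow> ('w \<Rightarrow> real ^ 'j) \<Rightarrow> ('w \<Rightarrow> real) \<Rightarrow> 'w \<Rightarrow> real ^ 'j" where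
  "qstar M F P Y \<omega> = matrix_inv (cond_second_moment M F P \<omega>) *v cond_cross_moment M F P Y \<omega>"

end

theory Submission
  imports Defs
begin

text \<open>
  Let \<open>F\<close> and \<open>G\<close> be the sigma-algebras generated by \<open>V\<close> and by \<open>(X, V)\<close>. If \<open>E[Y | G]\<close> is linear
  in \<open>P = p(X)\<close> with coefficient \<open>q\<^sub>0(V)\<close>, multiplying by \<open>P\<close> and conditioning on \<open>F\<close> gives the normal
  equations \<open>E[P P' | F] q\<^sub>0(V) = E[P Y | F]\<close>, so \<open>q\<^sub>0(V) = q\<^sup>*(V)\<close> almost surely; the residual is then
  \<open>Y - E[Y | G]\<close>, which is orthogonal to every square-integrable function of \<open>(X, V)\<close>. Conversely,
  orthogonality to the constant \<open>1\<close> makes the residual integrable, and orthogonality to indicators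
  of events of \<open>G\<close> says that \<open>P \<bullet> q\<^sup>*(V)\<close> is a version of \<open>E[Y | G]\<close>.
\<close>

section \<open>Measurability of vectors and of matrix inversion\<close>

lemma borel_measurable_vec_nth [measurable]:
  "(\<lambda>x :: real ^ 'n. x $ i) \<in> borel_measurable borel"
  by (intro borel_measurable_continuous_onI continuous_intros)

lemma borel_measurable_vecI:
  fixes f :: "'a \<Rightarrow> real ^ 'n"
  assumes "\<And>i. (\<lambda>x. f x $ i) \<in> borel_measurable M"
  shows "f \<in> borel_measurable M"
  using assms
  by (subst borel_measurable_euclidean_space) (auto simp: Basis_vec_def inner_axis)

lemma matrix_inv_invertible:
  fixes A :: "real ^ 'n ^ 'n"
  assumes "invertible A"
  shows "A ** matrix_inv A = mat 1" "matrix_inv A ** A = mat 1"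
  using someI_ex[OF assms[unfolded invertible_def]] unfolding matrix_inv_def by auto

text \<open>
  A singular matrix has a constant, unspecified \<^const>\<open>matrix_inv\<close>; hence \<^const>\<open>matrix_inv\<close> is
  measurable everywhere, and not just on the invertible matrices.
\<close>

lemma matrix_inv_singular:
  fixes A :: "real ^ 'n ^ 'n"
  assumes "\<not> invertible A"
  shows "matrix_inv A = (SOME B. False)"
  using assms unfolding matrix_inv_def invertible_def by metis

text \<open>By Cramer's rule each component is a quotient of two determinants, hence of polynomials
  in the entries, where \<open>A x\<close> is invertible. On the measurable set where the
  determinant vanishes, it is a fixed linear form in \<open>b x\<close>.\<close>

lemma borel_measurable_matrix_inv_mult:
  fixes A :: "'a \<Rightarrow> real ^ 'n ^ 'n" and b :: "'a \<Rightarrow> real ^ 'n"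
  assumes A [measurable]: "\<And>i j. (\<lambda>x. A x $ i $ j) \<in> borel_measurable M"
    and b [measurable]: "\<And>i. (\<lambda>x. b x $ i) \<in> borel_measurable M"
  shows "(\<lambda>x. matrix_inv (A x) *v b x) \<in> borel_measurable M"
proof (rule borel_measurable_vecI)
  fix k :: 'n
  \<comment> \<open>The value that \<open>matrix_inv\<close> takes at every singular matrix.\<close>
  define K :: "real ^ 'n ^ 'n" where "K = (SOME B. False)"
  \<comment> \<open>Cramer's numerator matrix: \<open>A x\<close> with column \<open>k\<close>
    replaced by \<open>b x\<close>.\<close>
  define C :: "'a \<Rightarrow> real ^ 'n ^ 'n"
    where "C x = (\<chi> i j. if j = k then b x $ i else A x $ i $ j)" for x
  have det: "(\<lambda>x. det (D x)) \<in> borel_measurable M"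
    if [measurable]: "\<And>i j. (\<lambda>x. D x $ i $ j) \<in> borel_measurable M" for D :: "'a \<Rightarrow> real ^ 'n ^ 'n"
    unfolding det_def by measurable
  have [measurable]: "(\<lambda>x. det (A x)) \<in> borel_measurable M"
    by (rule det) measurable
  have [measurable]: "(\<lambda>x. det (C x)) \<in> borel_measurable M"
    \<comment> \<open>The test \<open>j = k\<close> does not involve \<open>x\<close>, so each entry
      of \<open>C\<close> is, as a function of \<open>x\<close>, an entry of \<open>b\<close> or one
      of \<open>A\<close>.\<close>
    by (rule det, unfold C_def vec_lambda_beta, case_tac "j = k") simp_all
  have "(matrix_inv (A x) *v b x) $ k
      = (if det (A x) \<noteq> 0 then det (C x) / det (A x) else (\<Sum>j\<in>UNIV. K $ k $ j * b x $ j))" for x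
  proof (cases "invertible (A x)")
    case True
    then have "A x *v (matrix_inv (A x) *v b x) = b x"
      by (simp add: matrix_vector_mul_assoc matrix_inv_invertible)
    with True show ?thesis
      by (simp add: invertible_det_nz cramer C_def)
  next
    case False
    then show ?thesis
      by (simp add: invertible_det_nz K_def matrix_inv_singular matrix_vector_mult_def)
  qed
  then show "(\<lambda>x. (matrix_inv (A x) *v b x) $ k) \<in> borel_measurable M"
    by simp
qed

section \<open>Generated sigma-algebras and factorisation through the generating map\<close>

lemma subalgebra_rv_algebra:
  assumes "Z \<in> borel_measurable M"
  shows "subalgebra M (rv_algebra M Z)"
  using assms unfolding subalgebra_def rv_algebra_def
  by (auto simp: sets_vimage_algebra2 measurable_sets)

lemma measurable_rv_algebra [measurable]: "Z \<in> borel_measurable (rv_algebra M Z)"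
  unfolding rv_algebra_def by (rule measurable_vimage_algebra1) simp

lemma space_rv_algebra [simp]: "space (rv_algebra M Z) = space M"
  by (simp add: rv_algebra_def)

lemma sets_rv_algebraE:
  assumes "A \<in> sets (rv_algebra M Z)"
  obtains B where "B \<in> sets borel" "A = Z -` B \<inter> space M"
  using assms unfolding rv_algebra_def by (auto simp: sets_vimage_algebra2)

text \<open>
  Doob--Dynkin factorisation: \<open>g v\<close> is the infimum of the rationals \<open>q\<close> whose sublevel set
  \<open>{f < q}\<close> contains the fibre over \<open>v\<close>.
\<close>

lemma rv_algebra_factor_real:
  fixes f :: "'w \<Rightarrow> real"
  assumes "f \<in> borel_measurable (rv_algebra M Z)"
  obtains g where "g \<in> borel_measurable borel" "\<And>\<omega>. \<omega> \<in> space M \<Longrightarrow> f \<omega> = g (Z \<omega>)"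
proof -
  have "\<exists>B. B \<in> sets borel \<and> {\<omega> \<in> space M. f \<omega> < q} = Z -` B \<inter> space M" for q
  proof -
    have "{\<omega> \<in> space (rv_algebra M Z). f \<omega> < q} \<in> sets (rv_algebra M Z)"
      using assms by measurable
    then show ?thesis
      by (rule sets_rv_algebraE) (metis space_rv_algebra)
  qed
  then obtain B where B [measurable]: "\<And>q. B q \<in> sets borel"
    and B_eq: "\<And>q. {\<omega> \<in> space M. f \<omega> < q} = Z -` B q \<inter> space M"
    by metis
  \<comment> \<open>At points outside the range of \<open>Z\<close> the infimum can be infinite, so
    it is taken in the extended reals; \<open>real_of_ereal\<close> makes it real-valued at the
    end.\<close>
  define h where "h v = (INF q\<in>\<rat>. if v \<in> B q then ereal q else \<infinity>)" for v
  have h [measurable]: "h \<in> borel_measurable borel"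
    unfolding h_def by (intro borel_measurable_INF) (auto simp: countable_rat)
  have "h (Z \<omega>) = ereal (f \<omega>)" if "\<omega> \<in> space M" for \<omega>
  proof (rule antisym)
    have iff: "Z \<omega> \<in> B q \<longleftrightarrow> f \<omega> < q" for q
      using B_eq[of q] that by auto
    show "ereal (f \<omega>) \<le> h (Z \<omega>)"
      unfolding h_def by (intro INF_greatest) (auto simp: iff)
    show "h (Z \<omega>) \<le> ereal (f \<omega>)"
    proof (rule dense_ge)
      fix z assume "ereal (f \<omega>) < z"
      then obtain q where q: "ereal (f \<omega>) < ereal (real_of_rat q)" "ereal (real_of_rat q) < z"
        using ereal_dense3 by blast
      have "h (Z \<omega>) \<le> ereal (real_of_rat q)"
        unfolding h_def by (rule INF_lower2[of "real_of_rat q"]) (use q(1) in \<open>auto simp: iff\<close>)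
      with q(2) show "h (Z \<omega>) \<le> z" by order
    qed
  qed
  then have "f \<omega> = real_of_ereal (h (Z \<omega>))" if "\<omega> \<in> space M" for \<omega>
    using that by simp
  with h show thesis
    by (intro that[of "\<lambda>v. real_of_ereal (h v)"]) auto
qed

lemma rv_algebra_factor_vec:
  fixes f :: "'w \<Rightarrow> real ^ 'n"
  assumes [measurable]: "f \<in> borel_measurable (rv_algebra M Z)"
  obtains g where "g \<in> borel_measurable borel" "\<And>\<omega>. \<omega> \<in> space M \<Longrightarrow> f \<omega> = g (Z \<omega>)"
proof -
  have "\<exists>g. g \<in> borel_measurable borel \<and> (\<forall>\<omega>\<in>space M. f \<omega> $ i = g (Z \<omega>))" for i
  proof -
    have "(\<lambda>\<omega>. f \<omega> $ i) \<in> borel_measurable (rv_algebra M Z)"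
      by measurable
    then show ?thesis
      by (rule rv_algebra_factor_real) blast
  qed
  then obtain g where g: "\<And>i. g i \<in> borel_measurable borel"
    and eq: "\<And>i \<omega>. \<omega> \<in> space M \<Longrightarrow> f \<omega> $ i = g i (Z \<omega>)"
    by metis
  show thesis
  proof (rule that)
    show "(\<lambda>v. \<chi> i. g i v) \<in> borel_measurable borel"
      by (rule borel_measurable_vecI) (simp add: g)
  qed (simp add: vec_eq_iff eq)
qed

section \<open>Localised conditional moments and the normal equations\<close>

text \<open>Since \<open>A\<close> lies in \<open>F\<close>, the integral of \<bar>f\<bar> over
  \<open>A\<close> equals that of its conditional expectation, which is at most \<open>c\<close>
  there, and the measure is finite. This turns finite conditional moments into genuine integrability
  on suitable events.\<close>

lemma (in finite_measure_subalgebra) integrable_indicator_cond_bounded: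
  fixes f :: "'a \<Rightarrow> real"
  assumes [measurable]: "f \<in> borel_measurable M" "A \<in> sets F"
    and bound: "\<And>x. x \<in> A \<Longrightarrow> nn_cond_exp M F (\<lambda>x. ennreal \<bar>f x\<bar>) x \<le> ennreal c"
  shows "integrable M (\<lambda>x. indicator A x * f x)"
proof -
  have [measurable]: "A \<in> sets M"
    using assms(2) subalg by (auto simp: subalgebra_def)
  have "(\<integral>\<^sup>+ x. ennreal (norm (indicator A x * f x)) \<partial>M)
      = (\<integral>\<^sup>+ x. indicator A x * ennreal \<bar>f x\<bar> \<partial>M)"
    by (intro nn_integral_cong) (auto split: split_indicator)
  also have "\<dots> = (\<integral>\<^sup>+ x. indicator A x * nn_cond_exp M F (\<lambda>x. ennreal \<bar>f x\<bar>) x \<partial>M)"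
    by (rule nn_cond_exp_intg[symmetric]) measurable
  also have "\<dots> \<le> (\<integral>\<^sup>+ x. ennreal c \<partial>M)"
    by (intro nn_integral_mono) (auto split: split_indicator simp: bound)
  also have "\<dots> < \<infinity>"
    by (simp add: ennreal_mult_less_top emeasure_finite less_top[symmetric] ennreal_mult_eq_top_iff)
  finally show ?thesis
    by (intro integrableI_bounded) auto
qed

text \<open>
  None of the products \<open>P i * P j\<close> and \<open>P i * Y\<close> need be integrable, so everything is localised
  to the events \<open>{b \<le> n}\<close> of \<open>F\<close>, which exhaust the space up to a null set.
\<close>

lemma cond_normal_equation:
  fixes M :: "'w measure" and P :: "'w \<Rightarrow> real ^ 'j" and u :: "'w \<Rightarrow> real ^ 'j"
  assumes "finite_measure M"
    and MG: "subalgebra M G" and GF: "subalgebra G F"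
    and P [measurable]: "P \<in> borel_measurable G"
    and u [measurable]: "u \<in> borel_measurable F"
    and Y: "integrable M Y"
    and PP: "\<And>i j. finite_cond_moment M F (\<lambda>\<omega>. P \<omega> $ i * P \<omega> $ j)"
    and PY: "\<And>i. finite_cond_moment M F (\<lambda>\<omega>. P \<omega> $ i * Y \<omega>)"
    and linear: "AE \<omega> in M. real_cond_exp M G Y \<omega> = P \<omega> \<bullet> u \<omega>"
  shows "AE \<omega> in M. cond_second_moment M F P \<omega> *v u \<omega> = cond_cross_moment M F P Y \<omega>"
proof -
  have MF: "subalgebra M F"
    using MG GF by (auto simp: subalgebra_def)
  interpret F: finite_measure_subalgebra M F
    using assms(1) MF by (simp add: finite_measure_subalgebra_def finite_measure_subalgebra_axioms_def)
  interpret G: finite_measure_subalgebra M G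
    using assms(1) MG by (simp add: finite_measure_subalgebra_def finite_measure_subalgebra_axioms_def)
  have [measurable]: "Y \<in> borel_measurable M" "P \<in> borel_measurable M" "u \<in> borel_measurable G"
      "u \<in> borel_measurable M"
    using Y measurable_from_subalg[OF MG P] measurable_from_subalg[OF GF u]
      measurable_from_subalg[OF MF u] by auto
  have "AE \<omega> in M. (\<Sum>j\<in>UNIV. real_cond_exp M F (\<lambda>\<omega>. P \<omega> $ i * P \<omega> $ j) \<omega> * u \<omega> $ j)
      = real_cond_exp M F (\<lambda>\<omega>. P \<omega> $ i * Y \<omega>) \<omega>" for i
  proof -
    \<comment> \<open>\<open>b\<close> sums all the nonnegative quantities that have to be bounded
      for row \<open>i\<close>, so \<open>b \<omega> \<le> n\<close> bounds each of them by
      \<open>n\<close>. It is \<open>F\<close>-measurable, so the indicator of \<open>A n\<close>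
      can be pulled out of conditional expectations given \<open>F\<close>.\<close>
    define b where "b \<omega> = (\<Sum>j\<in>UNIV. nn_cond_exp M F (\<lambda>\<omega>. ennreal \<bar>P \<omega> $ i * P \<omega> $ j\<bar>) \<omega>)
        + nn_cond_exp M F (\<lambda>\<omega>. ennreal \<bar>P \<omega> $ i * Y \<omega>\<bar>) \<omega> + ennreal (norm (u \<omega>))" for \<omega>
    define A where "A n = {\<omega> \<in> space F. b \<omega> \<le> ennreal (real n)}" for n :: nat
    have [measurable]: "b \<in> borel_measurable F"
      unfolding b_def by measurable
    have A_F [measurable]: "A n \<in> sets F" for n
      unfolding A_def by measurable
    have A_G [measurable]: "A n \<in> sets G" and A_M [measurable]: "A n \<in> sets M" for n
      using A_F[of n] GF MF by (auto simp: subalgebra_def)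
    have space: "space F = space M"
      using MF by (simp add: subalgebra_def)
    have cover: "AE \<omega> in M. \<exists>n. \<omega> \<in> A n"
    proof -
      have "AE \<omega> in M. \<forall>j. nn_cond_exp M F (\<lambda>\<omega>. ennreal \<bar>P \<omega> $ i * P \<omega> $ j\<bar>) \<omega> < \<infinity>"
        using PP by (simp add: finite_cond_moment_def AE_all_countable)
      then show ?thesis
        using PY[of i, unfolded finite_cond_moment_def] AE_space
      proof eventually_elim
        case (elim \<omega>)
        then have "b \<omega> < \<infinity>"
          by (simp add: b_def)
        then obtain n :: nat where "b \<omega> \<le> of_nat n"
          using ennreal_Ex_less_of_nat less_imp_le by fastforce
        with elim show ?case
          by (auto simp: A_def space ennreal_of_nat_eq_real_of_nat)
      qed
    qed
    have local: "AE \<omega> in M. \<omega> \<in> A n \<longrightarrow>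
        (\<Sum>j\<in>UNIV. real_cond_exp M F (\<lambda>\<omega>. P \<omega> $ i * P \<omega> $ j) \<omega> * u \<omega> $ j)
        = real_cond_exp M F (\<lambda>\<omega>. P \<omega> $ i * Y \<omega>) \<omega>" for n
    proof -
      let ?I = "indicator (A n) :: 'w \<Rightarrow> real"
      have le_n: "nn_cond_exp M F (\<lambda>\<omega>. ennreal \<bar>P \<omega> $ i * P \<omega> $ j\<bar>) \<omega> \<le> ennreal (real n)"
        "nn_cond_exp M F (\<lambda>\<omega>. ennreal \<bar>P \<omega> $ i * Y \<omega>\<bar>) \<omega> \<le> ennreal (real n)"
        "norm (u \<omega>) \<le> real n" if "\<omega> \<in> A n" for j \<omega>
      proof -
        have b: "b \<omega> \<le> ennreal (real n)"
          using that by (simp add: A_def)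
        have "nn_cond_exp M F (\<lambda>\<omega>. ennreal \<bar>P \<omega> $ i * P \<omega> $ j\<bar>) \<omega>
            \<le> (\<Sum>j\<in>UNIV. nn_cond_exp M F (\<lambda>\<omega>. ennreal \<bar>P \<omega> $ i * P \<omega> $ j\<bar>) \<omega>)"
          by (rule member_le_sum) auto
        also have "\<dots> \<le> b \<omega>"
          unfolding b_def by (simp add: add.assoc)
        finally show "nn_cond_exp M F (\<lambda>\<omega>. ennreal \<bar>P \<omega> $ i * P \<omega> $ j\<bar>) \<omega> \<le> ennreal (real n)"
          using b by (rule order_trans)
        have "nn_cond_exp M F (\<lambda>\<omega>. ennreal \<bar>P \<omega> $ i * Y \<omega>\<bar>) \<omega> \<le> b \<omega>"
          unfolding b_def by (simp add: add.commute add.left_commute)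
        then show "nn_cond_exp M F (\<lambda>\<omega>. ennreal \<bar>P \<omega> $ i * Y \<omega>\<bar>) \<omega> \<le> ennreal (real n)"
          using b by (rule order_trans)
        have "ennreal (norm (u \<omega>)) \<le> b \<omega>"
          unfolding b_def by simp
        then have "ennreal (norm (u \<omega>)) \<le> ennreal (real n)"
          using b by (rule order_trans)
        then show "norm (u \<omega>) \<le> real n"
          by simp
      qed
      have int_Y: "integrable M (\<lambda>\<omega>. ?I \<omega> * (P \<omega> $ i * Y \<omega>))"
        by (rule F.integrable_indicator_cond_bounded[where c = "real n"]) (auto intro: le_n)
      have int_P: "integrable M (\<lambda>\<omega>. ?I \<omega> * (P \<omega> $ i * P \<omega> $ j))" for j
        by (rule F.integrable_indicator_cond_bounded[where c = "real n"]) (auto intro: le_n)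
      \<comment> \<open>On \<open>A n\<close> the factor \<open>u \<omega> $ j\<close> is at most
        \<open>n\<close> in absolute value, so \<open>int_P\<close> supplies the dominating
        function.\<close>
      have int_uP: "integrable M (\<lambda>\<omega>. (?I \<omega> * u \<omega> $ j) * (P \<omega> $ i * P \<omega> $ j))" for j
      proof (rule Bochner_Integration.integrable_bound)
        show "integrable M (\<lambda>\<omega>. real n * (?I \<omega> * (P \<omega> $ i * P \<omega> $ j)))"
          using int_P by simp
        have "norm ((?I \<omega> * u \<omega> $ j) * (P \<omega> $ i * P \<omega> $ j))
            \<le> norm (real n * (?I \<omega> * (P \<omega> $ i * P \<omega> $ j)))" for \<omega>
        proof (cases "\<omega> \<in> A n")
          case True
          then have "\<bar>u \<omega> $ j\<bar> \<le> real n"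
            using component_le_norm_cart[of "u \<omega>" j] le_n(3)[of \<omega>] by linarith
          with True show ?thesis
            by (simp add: abs_mult mult_right_mono)
        qed simp
        then show "AE \<omega> in M. norm ((?I \<omega> * u \<omega> $ j) * (P \<omega> $ i * P \<omega> $ j))
            \<le> norm (real n * (?I \<omega> * (P \<omega> $ i * P \<omega> $ j)))"
          by simp
      qed measurable
      \<comment> \<open>\<open>A n\<close> lies in \<open>F\<close>, hence in \<open>G\<close>, so
        the factor in front of \<open>Y\<close> is \<open>G\<close>-measurable. Conditioning on
        \<open>G\<close> first lets \<open>linear\<close> replace \<open>Y\<close> by
        \<open>P \<bullet> u\<close>; the tower property then descends to \<open>F\<close>.\<close>
      have "AE \<omega> in M. real_cond_exp M G (\<lambda>\<omega>. (?I \<omega> * P \<omega> $ i) * Y \<omega>) \<omega>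
          = (?I \<omega> * P \<omega> $ i) * real_cond_exp M G Y \<omega>"
        using int_Y by (intro G.real_cond_exp_mult) (auto simp: mult.assoc)
      with linear have lin: "AE \<omega> in M. real_cond_exp M G (\<lambda>\<omega>. ?I \<omega> * (P \<omega> $ i * Y \<omega>)) \<omega>
          = (\<Sum>j\<in>UNIV. (?I \<omega> * u \<omega> $ j) * (P \<omega> $ i * P \<omega> $ j))"
        by eventually_elim
          (simp add: inner_vec_def sum_distrib_left mult.assoc mult.left_commute mult.commute)
      have nested: "AE \<omega> in M. real_cond_exp M F (real_cond_exp M G (\<lambda>\<omega>. ?I \<omega> * (P \<omega> $ i * Y \<omega>))) \<omega>
          = real_cond_exp M F (\<lambda>\<omega>. ?I \<omega> * (P \<omega> $ i * Y \<omega>)) \<omega>"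
        by (rule F.real_cond_exp_nested_subalg[OF MG GF int_Y])
      have subst: "AE \<omega> in M. real_cond_exp M F (real_cond_exp M G (\<lambda>\<omega>. ?I \<omega> * (P \<omega> $ i * Y \<omega>))) \<omega>
          = real_cond_exp M F (\<lambda>\<omega>. \<Sum>j\<in>UNIV. (?I \<omega> * u \<omega> $ j) * (P \<omega> $ i * P \<omega> $ j)) \<omega>"
        by (rule F.real_cond_exp_cong[OF lin]) measurable
      have sum: "AE \<omega> in M. real_cond_exp M F (\<lambda>\<omega>. \<Sum>j\<in>UNIV. (?I \<omega> * u \<omega> $ j) * (P \<omega> $ i * P \<omega> $ j)) \<omega>
          = (\<Sum>j\<in>UNIV. real_cond_exp M F (\<lambda>\<omega>. (?I \<omega> * u \<omega> $ j) * (P \<omega> $ i * P \<omega> $ j)) \<omega>)"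
        by (rule F.real_cond_exp_sum) (rule int_uP)
      \<comment> \<open>\<open>real_cond_exp_mult\<close> asks only that the whole product be
        integrable. The moment left inside the conditional expectation is therefore the original
        one, without the indicator, although it may fail to be integrable.\<close>
      have pull_u: "AE \<omega> in M. \<forall>j. real_cond_exp M F (\<lambda>\<omega>. (?I \<omega> * u \<omega> $ j) * (P \<omega> $ i * P \<omega> $ j)) \<omega>
          = (?I \<omega> * u \<omega> $ j) * real_cond_exp M F (\<lambda>\<omega>. P \<omega> $ i * P \<omega> $ j) \<omega>"
        unfolding AE_all_countable
        by (intro allI F.real_cond_exp_mult int_uP) measurable
      have pull_Y: "AE \<omega> in M. real_cond_exp M F (\<lambda>\<omega>. ?I \<omega> * (P \<omega> $ i * Y \<omega>)) \<omega>
          = ?I \<omega> * real_cond_exp M F (\<lambda>\<omega>. P \<omega> $ i * Y \<omega>) \<omega>"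
        by (intro F.real_cond_exp_mult int_Y) measurable
      \<comment> \<open>On \<open>A n\<close> the indicator is 1 and drops out of both
        sides.\<close>
      from nested subst sum pull_u pull_Y show ?thesis
        by eventually_elim (auto simp: mult.commute)
    qed
    have "AE \<omega> in M. \<forall>n. \<omega> \<in> A n \<longrightarrow>
        (\<Sum>j\<in>UNIV. real_cond_exp M F (\<lambda>\<omega>. P \<omega> $ i * P \<omega> $ j) \<omega> * u \<omega> $ j)
        = real_cond_exp M F (\<lambda>\<omega>. P \<omega> $ i * Y \<omega>) \<omega>"
      unfolding AE_all_countable using local by blast
    with cover show ?thesis
      by eventually_elim blast
  qed
  then have "AE \<omega> in M. \<forall>i. (\<Sum>j\<in>UNIV. real_cond_exp M F (\<lambda>\<omega>. P \<omega> $ i * P \<omega> $ j) \<omega> * u \<omega> $ j)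
      = real_cond_exp M F (\<lambda>\<omega>. P \<omega> $ i * Y \<omega>) \<omega>"
    by (simp add: AE_all_countable)
  then show ?thesis
    by eventually_elim
      (simp add: vec_eq_iff matrix_vector_mult_def cond_second_moment_def cond_cross_moment_def)
qed

section \<open>Linearity of E[Y | X, V] in p(X) and orthogonality of the residual\<close>

theorem theorem10:
  fixes M :: "'w measure"
    and Y :: "'w \<Rightarrow> real"
    and X :: "'w \<Rightarrow> 'x::euclidean_space"
    and V :: "'w \<Rightarrow> 'v::euclidean_space"
    and p :: "'x \<Rightarrow> real ^ 'j"
  assumes "prob_space M"
    and "Y \<in> borel_measurable M"
    and "X \<in> borel_measurable M"
    and "V \<in> borel_measurable M"
    and "p \<in> borel_measurable borel"
    and "\<And>i j. finite_cond_moment M (rv_algebra M V) (\<lambda>\<omega>. p (X \<omega>) $ i * p (X \<omega>) $ j)"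
    and "\<And>i. finite_cond_moment M (rv_algebra M V) (\<lambda>\<omega>. p (X \<omega>) $ i * Y \<omega>)"
    and "AE \<omega> in M. invertible (cond_second_moment M (rv_algebra M V) (\<lambda>\<omega>. p (X \<omega>)) \<omega>)"
    and "integrable M (\<lambda>\<omega>. (Y \<omega>)\<^sup>2)"
  shows "(\<exists>q0 :: 'v \<Rightarrow> real ^ 'j. q0 \<in> borel_measurable borel \<and>
            (AE \<omega> in M. real_cond_exp M (rv_algebra M (\<lambda>\<omega>. (X \<omega>, V \<omega>))) Y \<omega>
                         = p (X \<omega>) \<bullet> q0 (V \<omega>)))
     \<longleftrightarrow> (\<forall>a :: 'x \<times> 'v \<Rightarrow> real. a \<in> borel_measurable borel \<longrightarrow>
            integrable M (\<lambda>\<omega>. (a (X \<omega>, V \<omega>))\<^sup>2) \<longrightarrow>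
            (let r = (\<lambda>\<omega>. Y \<omega> - p (X \<omega>) \<bullet> qstar M (rv_algebra M V) (\<lambda>\<omega>. p (X \<omega>)) Y \<omega>)
             in integrable M (\<lambda>\<omega>. r \<omega> * a (X \<omega>, V \<omega>)) \<and>
                (\<integral>\<omega>. r \<omega> * a (X \<omega>, V \<omega>) \<partial>M) = 0))"
proof -
  define F where "F = rv_algebra M V"
  define Z where "Z = (\<lambda>\<omega>. (X \<omega>, V \<omega>))"
  define G where "G = rv_algebra M Z"
  define P where "P = (\<lambda>\<omega>. p (X \<omega>))"
  define Q where "Q = qstar M F P Y"
  define r where "r \<omega> = Y \<omega> - P \<omega> \<bullet> Q \<omega>" for \<omega>
  note [measurable] = assms(2-5)
  interpret prob_space M by fact
  have Z [measurable]: "Z \<in> borel_measurable M"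
    unfolding Z_def by measurable
  have MG: "subalgebra M G" and MF: "subalgebra M F"
    unfolding F_def G_def by (simp_all add: subalgebra_rv_algebra)
  have Z_G [measurable]: "Z \<in> borel_measurable G"
    unfolding G_def by measurable
  have "(\<lambda>\<omega>. fst (Z \<omega>)) \<in> borel_measurable G" "(\<lambda>\<omega>. snd (Z \<omega>)) \<in> borel_measurable G"
    by (rule measurable_compose[OF Z_G], intro borel_measurable_continuous_onI continuous_intros)+
  then have [measurable]: "X \<in> borel_measurable G" and V_G: "V \<in> borel_measurable G"
    by (simp_all add: Z_def)
  have V_F [measurable]: "V \<in> borel_measurable F"
    unfolding F_def by measurable
  \<comment> \<open>\<open>rv_algebra\<close> depends on its measure only through the space, and
    \<open>G\<close> has the same space as \<open>M\<close>; so \<open>V\<close> generates the same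
    sigma-algebra from either.\<close>
  have GF: "subalgebra G F"
    using subalgebra_rv_algebra[OF V_G] unfolding F_def G_def by (simp add: rv_algebra_def)
  have P_G [measurable]: "P \<in> borel_measurable G"
    unfolding P_def by measurable
  interpret G: finite_measure_subalgebra M G
    by (rule finite_measure_subalgebra.intro) (unfold_locales, rule MG)
  have Q_F [measurable]: "Q \<in> borel_measurable F"
    unfolding Q_def qstar_def[abs_def]
    by (rule borel_measurable_matrix_inv_mult) (simp_all add: cond_second_moment_def cond_cross_moment_def)
  have Q_G [measurable]: "Q \<in> borel_measurable G"
    by (rule measurable_from_subalg[OF GF Q_F])
  have [measurable]: "P \<in> borel_measurable M" "Q \<in> borel_measurable M"
    using measurable_from_subalg[OF MG P_G] measurable_from_subalg[OF MF Q_F] by auto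
  have r_M [measurable]: "r \<in> borel_measurable M"
    unfolding r_def by measurable
  have Y2: "integrable M (\<lambda>\<omega>. (Y \<omega>)\<^sup>2)"
    by fact
  have Y: "integrable M Y"
    using Y2 by (rule square_integrable_imp_integrable[rotated]) measurable
  have "(\<exists>q0. q0 \<in> borel_measurable borel \<and> (AE \<omega> in M. real_cond_exp M G Y \<omega> = P \<omega> \<bullet> q0 (V \<omega>)))
      \<longleftrightarrow> (\<forall>a. a \<in> borel_measurable borel \<longrightarrow> integrable M (\<lambda>\<omega>. (a (Z \<omega>))\<^sup>2) \<longrightarrow>
            integrable M (\<lambda>\<omega>. r \<omega> * a (Z \<omega>)) \<and> (\<integral>\<omega>. r \<omega> * a (Z \<omega>) \<partial>M) = 0)"
    (is "?lin \<longleftrightarrow> ?orth")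
  proof
    assume ?lin
    then obtain q0 :: "'v \<Rightarrow> real ^ 'j" where [measurable]: "q0 \<in> borel_measurable borel"
      and lin: "AE \<omega> in M. real_cond_exp M G Y \<omega> = P \<omega> \<bullet> q0 (V \<omega>)"
      by blast
    have "AE \<omega> in M. cond_second_moment M F P \<omega> *v q0 (V \<omega>) = cond_cross_moment M F P Y \<omega>"
      using assms(6,7) by (intro cond_normal_equation[OF _ MG GF P_G _ Y _ _ lin])
        (simp_all add: F_def[symmetric] P_def finite_measure_axioms)
    moreover have "AE \<omega> in M. invertible (cond_second_moment M F P \<omega>)"
      using assms(8) by (simp add: F_def P_def)
    \<comment> \<open>Where the second moment matrix is invertible, the normal equations have only
      one solution.\<close>
    ultimately have "AE \<omega> in M. Q \<omega> = q0 (V \<omega>)"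
    proof eventually_elim
      case (elim \<omega>)
      then show ?case
        unfolding Q_def qstar_def
        by (simp flip: elim(1) add: matrix_vector_mul_assoc matrix_inv_invertible)
    qed
    with lin have r_eq: "AE \<omega> in M. r \<omega> = Y \<omega> - real_cond_exp M G Y \<omega>"
      by eventually_elim (simp add: r_def)
    show ?orth
    proof (intro allI impI)
      fix a :: "'x \<times> 'v \<Rightarrow> real"
      assume [measurable]: "a \<in> borel_measurable borel" and a2: "integrable M (\<lambda>\<omega>. (a (Z \<omega>))\<^sup>2)"
      have aY: "integrable M (\<lambda>\<omega>. a (Z \<omega>) * Y \<omega>)"
      proof (rule Bochner_Integration.integrable_bound)
        show "integrable M (\<lambda>\<omega>. (a (Z \<omega>))\<^sup>2 + (Y \<omega>)\<^sup>2)"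
          using a2 Y2 by simp
        have "\<bar>x * y\<bar> \<le> x\<^sup>2 + y\<^sup>2" for x y :: real
          using sum_squares_bound[of "\<bar>x\<bar>" "\<bar>y\<bar>"] abs_ge_zero[of "x * y"]
          unfolding abs_mult power2_abs mult.assoc by linarith
        then show "AE \<omega> in M. norm (a (Z \<omega>) * Y \<omega>) \<le> norm ((a (Z \<omega>))\<^sup>2 + (Y \<omega>)\<^sup>2)"
          by simp
      qed measurable
      have aG: "(\<lambda>\<omega>. a (Z \<omega>)) \<in> borel_measurable G"
        by measurable
      \<comment> \<open>This provides both the integrability of \<open>a(Z) * E[Y | G]\<close> and
        the equality of its integral with that of \<open>a(Z) * Y\<close>, so the two terms of the
        residual cancel.\<close>
      note cond = G.real_cond_exp_intg[OF aY aG assms(2)]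
      have ae: "AE \<omega> in M. r \<omega> * a (Z \<omega>) = a (Z \<omega>) * Y \<omega> - a (Z \<omega>) * real_cond_exp M G Y \<omega>"
        using r_eq by eventually_elim (simp add: right_diff_distrib mult.commute)
      have "integrable M (\<lambda>\<omega>. r \<omega> * a (Z \<omega>))
          \<longleftrightarrow> integrable M (\<lambda>\<omega>. a (Z \<omega>) * Y \<omega> - a (Z \<omega>) * real_cond_exp M G Y \<omega>)"
        by (rule integrable_cong_AE[OF _ _ ae]) measurable
      moreover have "(\<integral>\<omega>. r \<omega> * a (Z \<omega>) \<partial>M)
          = (\<integral>\<omega>. a (Z \<omega>) * Y \<omega> - a (Z \<omega>) * real_cond_exp M G Y \<omega> \<partial>M)"
        by (rule integral_cong_AE[OF _ _ ae]) measurable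
      ultimately show "integrable M (\<lambda>\<omega>. r \<omega> * a (Z \<omega>)) \<and> (\<integral>\<omega>. r \<omega> * a (Z \<omega>) \<partial>M) = 0"
        using aY cond by simp
    qed
  next
    assume orth: ?orth
    \<comment> \<open>The integrability half of \<open>?orth\<close> makes
      \<open>P \<bullet> Q = Y - r\<close> integrable, as \<open>real_cond_exp_charact\<close>
      demands.\<close>
    have r_int: "integrable M r"
      using orth[rule_format, of "\<lambda>_. 1"] by simp
    have PQ_eq: "P \<omega> \<bullet> Q \<omega> = Y \<omega> - r \<omega>" for \<omega>
      by (simp add: r_def)
    have PQ: "integrable M (\<lambda>\<omega>. P \<omega> \<bullet> Q \<omega>)"
      unfolding PQ_eq using Y r_int by simp
    have "AE \<omega> in M. real_cond_exp M G Y \<omega> = P \<omega> \<bullet> Q \<omega>"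
    proof (rule G.real_cond_exp_charact[OF _ Y PQ])
      fix A assume "A \<in> sets G"
      \<comment> \<open>An event of \<open>G\<close> is a preimage under \<open>Z\<close>, so its
        indicator is an admissible test function \<open>a(Z)\<close>.\<close>
      then obtain B where B [measurable]: "B \<in> sets borel" and A: "A = Z -` B \<inter> space M"
        unfolding G_def by (rule sets_rv_algebraE)
      have [measurable]: "A \<in> sets M"
        unfolding A by measurable
      have "integrable M (\<lambda>\<omega>. (indicator B (Z \<omega>) :: real)\<^sup>2)"
        by (rule integrable_const_bound[where B = 1]) (auto split: split_indicator)
      then have "(\<integral>\<omega>. r \<omega> * indicator B (Z \<omega>) \<partial>M) = 0"
        using orth[rule_format, of "indicator B"] by simp
      also have "(\<integral>\<omega>. r \<omega> * indicator B (Z \<omega>) \<partial>M) = (\<integral>\<omega>\<in>A. r \<omega> \<partial>M)"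
        unfolding set_lebesgue_integral_def
        by (rule Bochner_Integration.integral_cong) (auto simp: A split: split_indicator)
      finally have "(\<integral>\<omega>\<in>A. r \<omega> \<partial>M) = 0" .
      moreover have "(\<integral>\<omega>\<in>A. Y \<omega> - r \<omega> \<partial>M) = (\<integral>\<omega>\<in>A. Y \<omega> \<partial>M) - (\<integral>\<omega>\<in>A. r \<omega> \<partial>M)"
        by (intro set_integral_diff; unfold set_integrable_def)
          (rule integrable_mult_indicator[OF _ Y] integrable_mult_indicator[OF _ r_int]; measurable)+
      ultimately show "(\<integral>\<omega>\<in>A. Y \<omega> \<partial>M) = (\<integral>\<omega>\<in>A. P \<omega> \<bullet> Q \<omega> \<partial>M)"
        by (simp add: PQ_eq)
    qed measurable
    \<comment> \<open>\<open>Q\<close> is a function on the sample space; its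
      \<open>F\<close>-measurability yields a Borel function of \<open>V\<close> that equals
      it.\<close>
    moreover obtain q0 where q0: "q0 \<in> borel_measurable borel"
      and "\<And>\<omega>. \<omega> \<in> space M \<Longrightarrow> Q \<omega> = q0 (V \<omega>)"
      using rv_algebra_factor_vec[of Q M V] Q_F unfolding F_def by blast
    ultimately have "AE \<omega> in M. real_cond_exp M G Y \<omega> = P \<omega> \<bullet> q0 (V \<omega>)"
      by (auto elim: AE_mp)
    with q0 show ?lin
      by blast
  qed
  then show ?thesis
    by (simp add: F_def G_def Z_def P_def Q_def r_def Let_def)
qed

end
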